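(* Let $d\geq 2$, let $i,j\geq 0$ with $j\leq i$, $I=[i,i+d-1]$ and $J=[j,j+d-2]$. If $1\leq r\leq d$, then \[ b^{I\setminus\{i+r-1\}}_J=\pi^{I\setminus\{i+r-1\}}_J\; b_{d-1,\,r-1}. \]
   Context: For integers $p,q\geq 0$, $b_{p,q}=\binom{p}{q}$, with $b_{p,q}=0$ if $q>p$. For $k\leq l$, $[k,l]=\{k,\ldots,l\}$. For finite sets $I=\{i_1<\cdots<i_m\}$, $J=\{j_1<\cdots<j_m\}$ of non-negative integers, $b^I_J$ is the determinant of the $m\times m$ matrix with $(r,s)$ entry $b_{i_r,j_s}$, and $\pi^I_J=\frac{b_{i_1,j_1}\cdots b_{i_m,j_1}}{b_{j_1,j_1}\cdots b_{j_m,j_1}}$ (a rational number). *)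

theory Defs
  imports "Jordan_Normal_Form.Determinant"
begin

text \<open>
  The minor of the Pascal matrix with rows \<open>I\<close> and columns \<open>J\<close>, both listed in increasing order.
  It is only meaningful when \<open>I\<close> and \<open>J\<close> are finite and \<open>card I = card J\<close>.
  The row and column positions are counted from 0.
\<close>
definition binom_minor :: "nat set \<Rightarrow> nat set \<Rightarrow> rat" where
  "binom_minor I J =
     det (mat (card I) (card J)
       (\<lambda>(r, s). of_nat ((sorted_list_of_set I ! r) choose (sorted_list_of_set J ! s))))"

text \<open>
  Here \<open>Min J\<close> is the first column index \<open>j\<^sub>1\<close>, so \<open>J\<close> has to be nonempty; every factor of the
  denominator is then positive, since \<open>Min J \<le> k\<close> for all \<open>k \<in> J\<close>.
\<close>
definition binom_ratio :: "nat set \<Rightarrow> nat set \<Rightarrow> rat" where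
  "binom_ratio I J =
     (\<Prod>k\<in>I. of_nat (k choose Min J)) / (\<Prod>k\<in>J. of_nat (k choose Min J))"

end

(*
  The identity (x choose (j+s)) * ((j+s) choose j) = (x choose j) * ((x-j) choose s) takes the factor
  binom_ratio out of the rows and columns, leaving the rows a, ..., a+n without a+q and the columns
  0, ..., n-1, where a = i-j, n = d-1 and q = r-1. Up to sign that minor is a cofactor of the last
  column of P = ((a+t) choose s), 0 <= t, s <= n. By Vandermonde's convolution P is a product of two
  unitriangular matrices, so det P = 1 and the cofactors of the last column form the last row of the
  inverse of P. Taking n-th finite differences shows that this row is (-1)^(n+t) * (n choose t).
*)
theory Submission
  imports Defs
begin

text \<open>Pascal's rule splits the coefficient in two; shifting the index in one part pairs
  \<open>g (Suc t)\<close> with \<open>g t\<close>. One order of differencing thus passes into the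
  function.\<close>

lemma finite_difference_Suc:
  fixes g :: "nat \<Rightarrow> 'a :: comm_ring_1"
  shows "(\<Sum>t\<le>Suc n. (-1) ^ (Suc n + t) * of_nat (Suc n choose t) * g t)
       = (\<Sum>t\<le>n. (-1) ^ (n + t) * of_nat (n choose t) * (g (Suc t) - g t))"
proof -
  have "(\<Sum>t\<le>Suc n. (-1) ^ (Suc n + t) * of_nat (Suc n choose t) * g t)
      = (-1) ^ Suc n * g 0
        + (\<Sum>t\<le>n. (-1) ^ (n + t) * (of_nat (n choose t) + of_nat (n choose Suc t)) * g (Suc t))"
    by (subst sum.atMost_Suc_shift) simp
  also have "\<dots> = (\<Sum>t\<le>n. (-1) ^ (n + t) * of_nat (n choose t) * g (Suc t))
      - ((-1) ^ n * g 0 - (\<Sum>t\<le>n. (-1) ^ (n + t) * of_nat (n choose Suc t) * g (Suc t)))"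
    by (simp add: algebra_simps sum.distrib)
  \<comment> \<open>The term at 0 and the shifted sum form one sum up to \<open>Suc n\<close>, whose
    top coefficient \<open>n choose Suc n\<close> is zero.\<close>
  also have "(-1) ^ n * g 0 - (\<Sum>t\<le>n. (-1) ^ (n + t) * of_nat (n choose Suc t) * g (Suc t))
      = (\<Sum>t\<le>Suc n. (-1) ^ (n + t) * of_nat (n choose t) * g t)"
    by (subst sum.atMost_Suc_shift) (simp add: sum_negf)
  also have "\<dots> = (\<Sum>t\<le>n. (-1) ^ (n + t) * of_nat (n choose t) * g t)"
    by (simp add: binomial_eq_0)
  finally show ?thesis
    by (simp add: algebra_simps sum_subtractf)
qed

text \<open>By Pascal's rule, differencing x choose s in x gives x choose (s - 1), or 0 if s = 0.
  Each step thus lowers s, which is why the induction varies it. For s up to n, only s = n survives,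
  with value 1.\<close>

lemma finite_difference_binomial:
  "(\<Sum>t\<le>n. (-1) ^ (n + t) * of_nat (n choose t) * of_nat ((a + t) choose s))
     = (if n \<le> s then of_nat (a choose (s - n)) else (0 :: 'a :: comm_ring_1))"
proof (induction n arbitrary: s)
  case 0
  show ?case by simp
next
  case (Suc n)
  show ?case
  proof (cases s)
    case 0
    then show ?thesis by (simp only: finite_difference_Suc) simp
  next
    case (Suc s')
    then show ?thesis by (simp only: finite_difference_Suc) (simp add: Suc.IH)
  qed
qed

text \<open>In the Leibniz formula every permutation meets each column exactly once, so the column
  factors give the same product in every term.\<close>

lemma det_scale_rows_columns:
  fixes f g :: "nat \<Rightarrow> 'a :: comm_ring_1"
  shows "det (mat n n (\<lambda>(r, s). f r * g s * b r s))
       = (\<Prod>r<n. f r) * (\<Prod>s<n. g s) * det (mat n n (\<lambda>(r, s). b r s))"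
proof -
  have "(\<Prod>r=0..<n. f r * g (p r) * b r (p r))
      = (\<Prod>r<n. f r) * (\<Prod>s<n. g s) * (\<Prod>r=0..<n. b r (p r))"
    if "p permutes {0..<n}" for p
    using prod.permute[OF that, of g] by (simp add: prod.distrib atLeast0LessThan o_def)
  moreover have "p r < n" if "p permutes {0..<n}" "r < n" for p r
    using permutes_in_image[OF that(1), of r] that(2) by simp
  ultimately show ?thesis
    by (simp add: det_def sum_distrib_left mult_ac)
qed

lemma det_shifted_Pascal:
  "det (mat n n (\<lambda>(t, s). of_nat ((a + t) choose s))) = (1 :: 'a :: idom)"
proof -
  define L :: "'a mat" where "L = mat n n (\<lambda>(t, k). of_nat (t choose k))"
  define U :: "'a mat" where
    "U = mat n n (\<lambda>(k, s). if k \<le> s then of_nat (a choose (s - k)) else 0)"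
  have carr: "L \<in> carrier_mat n n" "U \<in> carrier_mat n n"
    by (auto simp: L_def U_def)
  have "mat n n (\<lambda>(t, s). of_nat ((a + t) choose s)) = L * U"
  proof (rule eq_matI)
    fix t s
    assume "t < dim_row (L * U)" "s < dim_col (L * U)"
    then have ts: "t < n" "s < n"
      by (auto simp: L_def U_def)
    have "(L * U) $$ (t, s)
        = (\<Sum>k<n. of_nat (t choose k) * (if k \<le> s then of_nat (a choose (s - k)) else 0))"
      using ts by (simp add: L_def U_def scalar_prod_def atLeast0LessThan)
    \<comment> \<open>As s < n, the range up to s lies within that up to n - 1, and the entries of
      \<open>U\<close> with k > s vanish.\<close>
    also have "\<dots> = (\<Sum>k\<le>s. of_nat (t choose k) * of_nat (a choose (s - k)))"
      using ts by (intro sum.mono_neutral_cong_right) auto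
    also have "\<dots> = of_nat ((t + a) choose s)"
      by (simp flip: vandermonde)
    finally show "mat n n (\<lambda>(t, s). of_nat ((a + t) choose s)) $$ (t, s) = (L * U) $$ (t, s)"
      using ts by (simp add: add.commute)
  qed (auto simp: L_def U_def)
  moreover have "det L = 1"
    by (subst det_lower_triangular[of n])
       (auto simp: L_def prod_list_diag_prod binomial_eq_0)
  moreover have "det U = 1"
    by (subst det_upper_triangular[of _ n])
       (auto simp: U_def prod_list_diag_prod upper_triangular_def)
  ultimately show ?thesis
    using carr by (simp add: det_mult)
qed

text \<open>Increasing enumeration of the naturals other than q, in the same form as the row
  reindexing in \<open>mat_delete\<close>.\<close>

definition skip :: "nat \<Rightarrow> nat \<Rightarrow> nat" where
  "skip q t = (if t < q then t else Suc t)"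

lemma det_shifted_Pascal_skip_row:
  assumes "q \<le> n"
  shows "det (mat n n (\<lambda>(t, s). of_nat ((a + skip q t) choose s)))
       = (of_nat (n choose q) :: 'a :: idom)"
proof -
  define P :: "'a mat" where "P = mat (Suc n) (Suc n) (\<lambda>(t, s). of_nat ((a + t) choose s))"
  define W :: "'a mat" where "W = mat 1 (Suc n) (\<lambda>(_, t). (-1) ^ (n + t) * of_nat (n choose t))"
  define E :: "'a mat" where "E = mat 1 (Suc n) (\<lambda>(_, s). if s = n then 1 else 0)"
  have P: "P \<in> carrier_mat (Suc n) (Suc n)" and W: "W \<in> carrier_mat 1 (Suc n)"
    by (auto simp: P_def W_def)
  have "W * P = E"
  proof (rule eq_matI)
    fix u s
    assume "u < dim_row E" "s < dim_col E"
    then have us: "u = 0" "s < Suc n"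
      by (auto simp: E_def)
    then have "(W * P) $$ (u, s)
        = (\<Sum>t\<le>n. (-1) ^ (n + t) * of_nat (n choose t) * of_nat ((a + t) choose s))"
      by (simp add: W_def P_def scalar_prod_def atLeast0LessThan lessThan_Suc_atMost
               del: sum.op_ivl_Suc)
    then show "(W * P) $$ (u, s) = E $$ (u, s)"
      using us by (auto simp: finite_difference_binomial E_def)
  qed (auto simp: W_def P_def E_def)
  then have "E * adj_mat P = W * (P * adj_mat P)"
    using assoc_mult_mat[OF W P adj_mat(1)[OF P]] by simp
  \<comment> \<open>\<open>P * adj_mat P\<close> is \<open>det P\<close> times the identity, and
    \<open>det P = 1\<close>.\<close>
  also have "\<dots> = W"
    using adj_mat(2)[OF P] det_shifted_Pascal[of "Suc n" a, where 'a = 'a]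
      mult_smult_distrib[OF W one_carrier_mat, of 1] right_mult_one_mat[OF W]
    by (auto simp flip: P_def)
  finally have "(E * adj_mat P) $$ (0, q) = W $$ (0, q)"
    by simp
  \<comment> \<open>\<open>E\<close> selects the last row of the adjugate; the adjugate transposes,
    so this row holds the cofactors of the last column.\<close>
  moreover have "(E * adj_mat P) $$ (0, q) = cofactor P q n"
    using assms by (simp add: E_def P_def adj_mat_def scalar_prod_def)
  moreover have "mat_delete P q n = mat n n (\<lambda>(t, s). of_nat ((a + skip q t) choose s))"
    by (rule eq_matI) (auto simp: mat_delete_def P_def skip_def)
  ultimately have "(-1) ^ (n + q) * det (mat n n (\<lambda>(t, s). of_nat ((a + skip q t) choose s)))
      = (-1) ^ (n + q) * (of_nat (n choose q) :: 'a)"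
    using assms by (simp add: cofactor_def W_def add.commute)
  then show ?thesis
    by simp
qed

lemma strict_mono_skip: "strict_mono (skip q)"
  by (auto simp: strict_mono_def skip_def)

lemma atLeastAtMost_remove_eq_image_skip:
  assumes "q \<le> n"
  shows "{i..i + n} - {i + q} = (\<lambda>t. i + skip q t) ` {..<n}"
proof (intro equalityI subsetI)
  fix x
  assume x: "x \<in> {i..i + n} - {i + q}"
  show "x \<in> (\<lambda>t. i + skip q t) ` {..<n}"
  proof (cases "x < i + q")
    case True
    with x assms show ?thesis by (intro image_eqI[of _ _ "x - i"]) (auto simp: skip_def)
  next
    case False
    \<comment> \<open>Here x > i + q, so \<open>skip\<close> has added one and the preimage is one
      smaller.\<close>
    with x assms show ?thesis by (intro image_eqI[of _ _ "x - i - 1"]) (auto simp: skip_def)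
  qed
qed (use assms in \<open>auto simp: skip_def split: if_splits\<close>)

lemma sorted_list_of_set_image_strict_mono_lessThan:
  fixes f :: "nat \<Rightarrow> 'a :: linorder"
  assumes "strict_mono f"
  shows "sorted_list_of_set (f ` {..<n}) = map f [0..<n]"
proof -
  have "sorted (map f [0..<n])"
    using strict_mono_mono[OF assms] by (auto simp: sorted_iff_nth_mono monoD)
  moreover have "distinct (map f [0..<n])"
    using strict_mono_imp_inj_on[OF assms] by (auto simp: distinct_map intro: inj_on_subset)
  ultimately show ?thesis
    using sorted_list_of_set.idem_if_sorted_distinct[of "map f [0..<n]"]
    by (simp add: atLeast0LessThan)
qed

lemma binom_minor_image_strict_mono:
  assumes "strict_mono f" "strict_mono g"
  shows "binom_minor (f ` {..<n}) (g ` {..<n}) = det (mat n n (\<lambda>(r, s). of_nat (f r choose g s)))"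
  using assms
  by (auto simp: binom_minor_def sorted_list_of_set_image_strict_mono_lessThan card_image
        strict_mono_imp_inj_on intro!: arg_cong[of _ _ det] eq_matI)

theorem theorem6p2:
  fixes d i j r :: nat and I J :: "nat set"
  assumes "d \<ge> 2" and "j \<le> i"
    and "I = {i..i + d - 1}" and "J = {j..j + d - 2}"
    and "1 \<le> r" and "r \<le> d"
  shows "binom_minor (I - {i + r - 1}) J
       = binom_ratio (I - {i + r - 1}) J * of_nat ((d - 1) choose (r - 1))"
proof -
  define n where "n = d - 1"
  define q where "q = r - 1"
  have nq: "q \<le> n" "n > 0"
    using assms by (auto simp: n_def q_def)
  define f where "f = (\<lambda>t. i + skip q t)"
  have f_mono: "strict_mono f"
    using strict_mono_skip[of q] by (simp add: f_def strict_mono_def)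
  have j_mono: "strict_mono ((+) j)"
    by (simp add: strict_mono_def)
  have "I - {i + r - 1} = {i..i + n} - {i + q}"
    using assms by (auto simp: n_def q_def)
  then have I_eq: "I - {i + r - 1} = f ` {..<n}"
    by (simp only: atLeastAtMost_remove_eq_image_skip[OF nq(1)] f_def)
  have "J = {j..<j + n}"
    using assms by (auto simp: n_def)
  then have J_eq: "J = (+) j ` {..<n}"
    by (simp add: lessThan_atLeast0 image_add_atLeastLessThan add.commute)
  have Min_J: "Min J = j"
    using assms by (auto intro: Min_eqI)
  \<comment> \<open>Row factor times column factor times reduced entry, the shape needed to scale
    the determinant. The division is sound because (j + s) choose j is positive.\<close>
  have entry: "of_nat (f t choose (j + s))
      = of_nat (f t choose j) * (1 / of_nat ((j + s) choose j))
        * (of_nat ((i - j + skip q t) choose s) :: rat)" for t s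
  proof -
    have "f t - j = i - j + skip q t"
      using assms by (simp add: f_def)
    moreover have "(f t choose (j + s)) * ((j + s) choose j) = (f t choose j) * ((f t - j) choose s)"
    proof (cases "j + s \<le> f t")
      case True
      then show ?thesis
        using choose_mult[of j "j + s" "f t"] by simp
    next
      \<comment> \<open>Outside the range of \<open>choose_mult\<close> both sides are zero.\<close>
      case False
      then have "f t < j + s" "f t < j \<or> f t - j < s"
        by linarith+
      then show ?thesis
        by (auto simp: binomial_eq_0)
    qed
    ultimately have "of_nat (f t choose (j + s)) * of_nat ((j + s) choose j)
        = (of_nat (f t choose j) * of_nat ((i - j + skip q t) choose s) :: rat)"
      by (metis of_nat_mult)
    then show ?thesis
      by (simp add: field_simps)
  qed
  have "binom_minor (I - {i + r - 1}) J
      = (\<Prod>t<n. of_nat (f t choose j)) * (\<Prod>s<n. 1 / of_nat ((j + s) choose j))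
        * of_nat (n choose q)"
    unfolding I_eq J_eq binom_minor_image_strict_mono[OF f_mono j_mono] entry
      det_scale_rows_columns det_shifted_Pascal_skip_row[OF nq(1)] ..
  also have "(\<Prod>t<n. of_nat (f t choose j)) * (\<Prod>s<n. 1 / of_nat ((j + s) choose j))
      = binom_ratio (I - {i + r - 1}) J"
    \<comment> \<open>\<open>Min J\<close> has to be evaluated before \<open>J\<close> is rewritten
      as an image.\<close>
    unfolding binom_ratio_def Min_J unfolding I_eq J_eq
    by (simp add: prod.reindex strict_mono_imp_inj_on f_mono prod_dividef)
  finally show ?thesis
    by (simp add: n_def q_def)
qed

end
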